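(* Let $n\in\mathbb{N}$, $n\ge 2$. For all $a,b,c\in\mathbb{R}^n$ the following generalized Grassmann identity holds in $\mathbb{R}^n$: $$M_n(a)^T\,(b\times_n c)=\langle a,b\rangle\, c-\langle a,c\rangle\, b=(\langle b,a\rangle I_n-b\otimes a)\,c=(c\otimes b-b\otimes c)\,a=-\mathfrak{A}_n(b\times_n c)\,a .$$
   Context: Vectors are real column vectors, $\langle\cdot,\cdot\rangle$ is the Euclidean scalar product, $a\otimes b=ab^T$ is the dyadic product, and $I_n$ is the $n\times n$ identity matrix. For $a\in\mathbb{R}^n$ write $a=(\overline a,\alpha_n)^T$ with $\overline a\in\mathbb{R}^{n-1}$, and similarly for $b$. The generalized cross product $\times_n:\mathbb{R}^n\times\mathbb{R}^n\to\mathbb{R}^{n(n-1)/2}$ is defined inductively for $n\ge2$ by $$\begin{pmatrix}\alpha_1\\ \alpha_2\end{pmatrix}\times_2\begin{pmatrix}\beta_1\\ \beta_2\end{pmatrix}=\alpha_1\beta_2-\alpha_2\beta_1,\qquad a\times_n b=\begin{pmatrix}\overline a\times_{n-1}\overline b\\ \beta_n\overline a-\alpha_n\overline b\end{pmatrix}.$$ Equivalently, its entries are $\alpha_i\beta_j-\alpha_j\beta_i$ for $i<j$, listed in the order $(i,j)=(1,2),(1,3),(2,3),(1,4),(2,4),(3,4),\ldots$. For $a\in\mathbb{R}^n$, $M_n(a)\in\mathbb{R}^{\frac{n(n-1)}{2}\times n}$ denotes the unique matrix with $M_n(a)\,b=a\times_n b$ for all $b\in\mathbb{R}^n$. Let $\mathfrak{so}(n)$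 be the space of real skew-symmetric $n\times n$ matrices. The bijection $\mathfrak{A}_n:\mathbb{R}^{n(n-1)/2}\to\mathfrak{so}(n)$ is the inverse of the map $(\alpha_{ij})\mapsto(\alpha_{12},\alpha_{13},\alpha_{23},\ldots,\alpha_{1n},\ldots,\alpha_{(n-1)n})^T$ on $\mathfrak{so}(n)$, which lists the strictly upper triangular entries $\alpha_{ij}$, $i<j$, in the order $(i,j)=(1,2),(1,3),(2,3),(1,4),(2,4),(3,4),\ldots$. *)

theory Defs
  imports Complex_Main "Jordan_Normal_Form.Matrix"
begin

text \<open>
  Vectors of \<open>\<real>\<^sup>n\<close> are elements of \<^term>\<open>carrier_vec n :: real vec set\<close>.  Indices start at 0, so
  the last component \<open>\<alpha>\<^sub>n\<close> of a vector \<open>a\<close> is \<open>a $ (n - 1)\<close>, and its truncation is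
  \<open>vec_first a (n - 1)\<close>.
\<close>

text \<open>Only \<open>n \<ge> 2\<close> is meaningful; the first two equations are dummy values in \<open>\<real>\<^sup>0\<close>.\<close>

fun gcross :: "nat \<Rightarrow> real vec \<Rightarrow> real vec \<Rightarrow> real vec" where
  "gcross 0 a b = 0\<^sub>v 0"
| "gcross (Suc 0) a b = 0\<^sub>v 0"
| "gcross (Suc (Suc 0)) a b = vec 1 (\<lambda>_. a $ 0 * b $ 1 - a $ 1 * b $ 0)"
| "gcross (Suc (Suc (Suc m))) a b =
     (let n = Suc (Suc m); a' = vec_first a n; b' = vec_first b n in
      gcross n a' b' @\<^sub>v (b $ n \<cdot>\<^sub>v a' - a $ n \<cdot>\<^sub>v b'))"

definition gcross_mat :: "nat \<Rightarrow> real vec \<Rightarrow> real mat" where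
  "gcross_mat n a = (THE M. M \<in> carrier_mat (n * (n - 1) div 2) n \<and>
                            (\<forall>b \<in> carrier_vec n. M *\<^sub>v b = gcross n a b))"

text \<open>The dyadic product as the product \<open>a b\<^sup>T\<close> of a column and a row.\<close>

definition dyadic :: "real vec \<Rightarrow> real vec \<Rightarrow> real mat" where
  "dyadic a b = transpose_mat (mat_of_row a) * mat_of_row b"

definition skew_mats :: "nat \<Rightarrow> real mat set" where
  "skew_mats n = {A \<in> carrier_mat n n. transpose_mat A = - A}"

text \<open>The strictly upper triangular positions, column by column:
  \<open>(0,1), (0,2), (1,2), (0,3), (1,3), (2,3), \<dots>\<close>\<close>

definition upper_pairs :: "nat \<Rightarrow> (nat \<times> nat) list" where
  "upper_pairs n = concat (map (\<lambda>j. map (\<lambda>i. (i, j)) [0..<j]) [0..<n])"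

definition upper_entries :: "nat \<Rightarrow> real mat \<Rightarrow> real vec" where
  "upper_entries n A = vec_of_list (map (\<lambda>ij. A $$ ij) (upper_pairs n))"

definition skew_of_vec :: "nat \<Rightarrow> real vec \<Rightarrow> real mat" where
  "skew_of_vec n = the_inv_into (skew_mats n) (upper_entries n)"

text \<open>Both \<^const>\<open>gcross_mat\<close> and \<^const>\<open>skew_of_vec\<close> are well defined: the matrix described in the
  former exists and is unique, and the map inverted in the latter is a bijection.\<close>

lemma upper_pairs_Suc: "upper_pairs (Suc n) = upper_pairs n @ map (\<lambda>i. (i, n)) [0..<n]"
  by (simp add: upper_pairs_def)

lemma set_upper_pairs: "set (upper_pairs n) = {(i, j). i < j \<and> j < n}"
  by (force simp: upper_pairs_def)

lemma distinct_upper_pairs: "distinct (upper_pairs n)"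
proof (induction n)
  case 0
  then show ?case by (simp add: upper_pairs_def)
next
  case (Suc n)
  then show ?case by (auto simp: upper_pairs_Suc set_upper_pairs distinct_map inj_on_def)
qed

lemma length_upper_pairs: "length (upper_pairs n) = n * (n - 1) div 2"
proof (induction n)
  case 0
  then show ?case by (simp add: upper_pairs_def)
next
  case (Suc n)
  have "Suc n * (Suc n - 1) = n * (n - 1) + n * 2"
    by (cases n) (auto simp: algebra_simps)
  then have "Suc n * (Suc n - 1) div 2 = n * (n - 1) div 2 + n"
    by simp
  with Suc show ?case by (simp add: upper_pairs_Suc)
qed

lemma gcross_entries:
  "gcross n a b = vec_of_list (map (\<lambda>(i, j). a $ i * b $ j - a $ j * b $ i) (upper_pairs n))"
proof (induction n a b rule: gcross.induct)
  case (3 a b)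
  show ?case
    by (rule eq_vecI) (auto simp: upper_pairs_def numeral_2_eq_2 vec_of_list_index)
next
  case (4 m a b)
  define n where "n = Suc (Suc m)"
  have IH: "gcross n (vec_first a n) (vec_first b n) =
      vec_of_list (map (\<lambda>(i, j). a $ i * b $ j - a $ j * b $ i) (upper_pairs n))"
    unfolding n_def 4[OF refl refl refl]
    by (intro arg_cong[where f = vec_of_list] map_cong)
      (auto simp: set_upper_pairs vec_first_def)
  have "gcross (Suc n) a b = gcross n (vec_first a n) (vec_first b n) @\<^sub>v
      (b $ n \<cdot>\<^sub>v vec_first a n - a $ n \<cdot>\<^sub>v vec_first b n)"
    by (simp add: n_def Let_def)
  also have "\<dots> = vec_of_list (map (\<lambda>(i, j). a $ i * b $ j - a $ j * b $ i) (upper_pairs (Suc n)))"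
    unfolding IH
    by (rule eq_vecI)
      (auto simp: upper_pairs_Suc vec_of_list_index nth_append vec_first_def)
  finally show ?case by (simp only: n_def)
qed (auto simp: upper_pairs_def intro!: eq_vecI)

lemma gcross_carrier: "gcross n a b \<in> carrier_vec (n * (n - 1) div 2)"
proof -
  have "dim_vec (gcross n a b) = length (upper_pairs n)"
    unfolding gcross_entries by simp
  then show ?thesis
    unfolding length_upper_pairs by (rule carrier_vecI)
qed

lemma gcross_mat_unique_exists:
  "\<exists>!M. M \<in> carrier_mat (n * (n - 1) div 2) n \<and> (\<forall>b \<in> carrier_vec n. M *\<^sub>v b = gcross n a b)"
proof -
  define N where "N = n * (n - 1) div 2"
  have len: "length (upper_pairs n) = N"
    by (simp only: length_upper_pairs N_def)
  define F where "F k l = (case upper_pairs n ! k of (i, j) \<Rightarrow>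
    (if l = j then a $ i else 0) - (if l = i then a $ j else 0))" for k l
  define M where "M = mat N n (\<lambda>(k, l). F k l)"
  have M: "M \<in> carrier_mat N n"
    by (simp add: M_def)
  have mult: "M *\<^sub>v b = gcross n a b" if b: "b \<in> carrier_vec n" for b
  proof (rule eq_vecI)
    show "dim_vec (M *\<^sub>v b) = dim_vec (gcross n a b)"
      using M len by (simp add: gcross_entries)
    fix k assume "k < dim_vec (gcross n a b)"
    then have k: "k < N"
      using len by (simp add: gcross_entries)
    define i j where "i = fst (upper_pairs n ! k)" and "j = snd (upper_pairs n ! k)"
    then have ij: "upper_pairs n ! k = (i, j)" by (simp add: i_def j_def)
    have "(i, j) \<in> set (upper_pairs n)"
      using k len ij nth_mem by metis
    then have lt: "i < n" "j < n"
      by (simp_all add: set_upper_pairs)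
    have "(M *\<^sub>v b) $ k = (\<Sum>l = 0..<n. F k l * b $ l)"
      using k b by (simp add: M_def scalar_prod_def)
    also have "\<dots> = (\<Sum>l = 0..<n. (if l = j then a $ i * b $ l else 0) -
        (if l = i then a $ j * b $ l else 0))"
      by (intro sum.cong) (auto simp: F_def ij)
    also have "\<dots> = a $ i * b $ j - a $ j * b $ i"
      using lt by (simp add: sum_subtractf)
    also have "\<dots> = gcross n a b $ k"
      using k by (simp add: gcross_entries vec_of_list_index len ij)
    finally show "(M *\<^sub>v b) $ k = gcross n a b $ k" .
  qed
  have unique: "X = M"
    if X: "X \<in> carrier_mat N n" "\<forall>b \<in> carrier_vec n. X *\<^sub>v b = gcross n a b" for X
  proof (rule eq_matI)
    fix i j assume "i < dim_row M" "j < dim_col M"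
    then have lt: "i < N" "j < n"
      using M by auto
    have entry: "(Y *\<^sub>v unit_vec n j) $ i = Y $$ (i, j)" if "Y \<in> carrier_mat N n" for Y :: "real mat"
      using that lt by simp
    have "X *\<^sub>v unit_vec n j = M *\<^sub>v unit_vec n j"
      using X(2) mult by simp
    then show "X $$ (i, j) = M $$ (i, j)"
      using entry[OF X(1)] entry[OF M] by simp
  qed (use X(1) M in auto)
  show ?thesis
    unfolding N_def[symmetric] using M mult unique by (intro ex1I[of _ M]) blast+
qed

lemma upper_entries_bij_betw:
  "bij_betw (upper_entries n) (skew_mats n) (carrier_vec (n * (n - 1) div 2))"
proof (rule bij_betw_imageI)
  have skewD: "A $$ (j, i) = - A $$ (i, j)" if "A \<in> skew_mats n" "i < n" "j < n" for A i j
  proof -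
    have A: "A \<in> carrier_mat n n" and T: "transpose_mat A = - A"
      using that(1) by (simp_all add: skew_mats_def)
    have "A $$ (j, i) = transpose_mat A $$ (i, j)"
      using A that by simp
    also have "\<dots> = - A $$ (i, j)"
      unfolding T using A that by simp
    finally show ?thesis .
  qed
  show "inj_on (upper_entries n) (skew_mats n)"
  proof (rule inj_onI)
    fix A B assume A: "A \<in> skew_mats n" and B: "B \<in> skew_mats n"
      and eq: "upper_entries n A = upper_entries n B"
    from eq have "map (\<lambda>ij. A $$ ij) (upper_pairs n) = map (\<lambda>ij. B $$ ij) (upper_pairs n)"
      unfolding upper_entries_def by (metis list_vec)
    then have up: "A $$ (i, j) = B $$ (i, j)" if "i < j" "j < n" for i j
      using that by (auto simp: set_upper_pairs)
    have "A $$ (i, j) = B $$ (i, j)" if ij: "i < n" "j < n" for i j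
    proof -
      consider "i < j" | "j < i" | "i = j" by linarith
      then show ?thesis
      proof cases
        case 1
        then show ?thesis using up ij by simp
      next
        case 2
        then have "A $$ (j, i) = B $$ (j, i)" using up ij by simp
        with skewD[OF A ij(2,1)] skewD[OF B ij(2,1)] show ?thesis by metis
      next
        case 3
        have "A $$ (i, i) = 0" "B $$ (i, i) = 0"
          using skewD[OF A ij(1,1)] skewD[OF B ij(1,1)] by linarith+
        with 3 show ?thesis by simp
      qed
    qed
    then show "A = B"
      using A B by (intro eq_matI) (auto simp: skew_mats_def)
  qed
  show "upper_entries n ` skew_mats n = carrier_vec (n * (n - 1) div 2)"
  proof (intro equalityI subsetI)
    fix v :: "real vec" assume "v \<in> carrier_vec (n * (n - 1) div 2)"
    then have v: "dim_vec v = length (upper_pairs n)"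
      by (simp add: length_upper_pairs)
    define f where "f p = v $ (the_inv_into {..<length (upper_pairs n)} ((!) (upper_pairs n)) p)" for p
    have f: "f (upper_pairs n ! k) = v $ k" if "k < length (upper_pairs n)" for k
      using that the_inv_into_f_f[OF inj_on_nth[OF distinct_upper_pairs]] by (simp add: f_def)
    define A where "A = mat n n (\<lambda>(i, j). if i < j then f (i, j) else if j < i then - f (j, i) else 0)"
    have "A \<in> skew_mats n"
      by (auto simp: skew_mats_def A_def)
    moreover have "upper_entries n A = v"
    proof (rule eq_vecI)
      fix k assume "k < dim_vec v"
      with v have k: "k < length (upper_pairs n)" by simp
      obtain i j where ij: "upper_pairs n ! k = (i, j)" by fastforce
      with k have "i < j" "j < n"
        using nth_mem[of k "upper_pairs n"] by (auto simp: set_upper_pairs)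
      with k ij f[OF k] show "upper_entries n A $ k = v $ k"
        by (simp add: upper_entries_def vec_of_list_index A_def)
    qed (simp add: upper_entries_def v)
    ultimately show "v \<in> upper_entries n ` skew_mats n" by blast
  qed (auto simp: upper_entries_def length_upper_pairs intro!: carrier_vecI)
qed

end

theory Submission
  imports Defs
begin

text \<open>
  Write \<open>M\<close> for the matrix of \<open>x \<mapsto> a \<times> x\<close>.  The first equation is the Binet--Cauchy identity
  \<open>(p \<times> q) \<bullet> (r \<times> s) = (p \<bullet> r) (q \<bullet> s) - (p \<bullet> s) (q \<bullet> r)\<close> read through the adjoint: the \<open>k\<close>-th
  component of \<open>M\<^sup>T (b \<times> c)\<close> is \<open>(M e) \<bullet> (b \<times> c) = (a \<times> e) \<bullet> (b \<times> c)\<close> for the \<open>k\<close>-th unit vector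
  \<open>e\<close>, and Binet--Cauchy turns this into the \<open>k\<close>-th component of \<open>(a \<bullet> b) c - (a \<bullet> c) b\<close>
  (lemmas \<open>gcross_scalar_prod_gcross\<close> and \<open>transpose_gcross_mat_mult_gcross\<close>).

  The next two expressions only regroup this vector by means of \<open>(u \<otimes> v) w = (v \<bullet> w) u\<close>
  (lemma \<open>dyadic_mult_vec\<close>).  For the last one, \<open>b \<otimes> c - c \<otimes> b\<close> is skew-symmetric and its strictly
  upper triangular entries are \<open>b\<^sub>i c\<^sub>j - b\<^sub>j c\<^sub>i\<close>, the entries of \<open>b \<times> c\<close>; hence it is the skew
  matrix belonging to \<open>b \<times> c\<close> (lemma \<open>skew_of_vec_gcross\<close>).
\<close>

text \<open>Adding the index \<open>n\<close> adds the pairs \<open>(i, n)\<close> with \<open>i < n\<close> on the left.  Their contribution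
  is the sum of the mixed terms on the right; the two terms with index \<open>n\<close> alone cancel.\<close>

lemma sum_upper_pairs_Binet_Cauchy:
  fixes p q r s :: "nat \<Rightarrow> real"
  shows "(\<Sum>(i, j)\<leftarrow>upper_pairs n. (p i * q j - p j * q i) * (r i * s j - r j * s i)) =
    (\<Sum>i<n. p i * r i) * (\<Sum>i<n. q i * s i) - (\<Sum>i<n. p i * s i) * (\<Sum>i<n. q i * r i)"
proof (induction n)
  case 0
  then show ?case by (simp add: upper_pairs_def)
next
  case (Suc n)
  have "(\<Sum>i\<leftarrow>[0..<n]. (p i * q n - p n * q i) * (r i * s n - r n * s i)) =
      (\<Sum>i<n. (p i * q n - p n * q i) * (r i * s n - r n * s i))"
    by (simp add: interv_sum_list_conv_sum_set_nat atLeast0LessThan)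
  also have "\<dots> = (\<Sum>i<n. q n * s n * (p i * r i) + p n * r n * (q i * s i)
      - q n * r n * (p i * s i) - p n * s n * (q i * r i))"
    by (intro sum.cong) (auto simp: algebra_simps)
  also have "\<dots> = q n * s n * (\<Sum>i<n. p i * r i) + p n * r n * (\<Sum>i<n. q i * s i)
      - q n * r n * (\<Sum>i<n. p i * s i) - p n * s n * (\<Sum>i<n. q i * r i)"
    by (simp add: sum.distrib sum_subtractf sum_distrib_left)
  finally show ?case
    using Suc by (simp add: upper_pairs_Suc comp_def algebra_simps)
qed

lemma gcross_scalar_prod_gcross:
  assumes "p \<in> carrier_vec n" "q \<in> carrier_vec n" "r \<in> carrier_vec n" "s \<in> carrier_vec n"
  shows "gcross n p q \<bullet> gcross n r s = (p \<bullet> r) * (q \<bullet> s) - (p \<bullet> s) * (q \<bullet> r)"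
proof -
  have "gcross n p q \<bullet> gcross n r s = (\<Sum>(i, j)\<leftarrow>upper_pairs n.
      (p $ i * q $ j - p $ j * q $ i) * (r $ i * s $ j - r $ j * s $ i))"
    by (auto simp: gcross_entries scalar_prod_def vec_of_list_index sum_list_sum_nth
        case_prod_beta intro!: sum.cong)
  then show ?thesis
    using assms
    by (simp add: sum_upper_pairs_Binet_Cauchy scalar_prod_def atLeast0LessThan)
qed

lemma gcross_mat_carrier: "gcross_mat n a \<in> carrier_mat (n * (n - 1) div 2) n"
  and gcross_mat_mult_vec: "b \<in> carrier_vec n \<Longrightarrow> gcross_mat n a *\<^sub>v b = gcross n a b"
  using theI'[OF gcross_mat_unique_exists[of n a]] unfolding gcross_mat_def by blast+

lemma transpose_gcross_mat_mult_gcross: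
  assumes "a \<in> carrier_vec n" "b \<in> carrier_vec n" "c \<in> carrier_vec n"
  shows "transpose_mat (gcross_mat n a) *\<^sub>v gcross n b c = (a \<bullet> b) \<cdot>\<^sub>v c - (a \<bullet> c) \<cdot>\<^sub>v b"
proof (rule eq_vecI)
  show "dim_vec (transpose_mat (gcross_mat n a) *\<^sub>v gcross n b c) =
      dim_vec ((a \<bullet> b) \<cdot>\<^sub>v c - (a \<bullet> c) \<cdot>\<^sub>v b)"
    using gcross_mat_carrier[of n a] assms by simp
  fix k assume "k < dim_vec ((a \<bullet> b) \<cdot>\<^sub>v c - (a \<bullet> c) \<cdot>\<^sub>v b)"
  then have k: "k < n"
    using assms by simp
  have "col (gcross_mat n a) k = gcross_mat n a *\<^sub>v unit_vec n k"
    using gcross_mat_carrier[of n a] k by (intro eq_vecI) auto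
  also have "\<dots> = gcross n a (unit_vec n k)"
    by (simp add: gcross_mat_mult_vec)
  finally have "(transpose_mat (gcross_mat n a) *\<^sub>v gcross n b c) $ k =
      gcross n a (unit_vec n k) \<bullet> gcross n b c"
    using gcross_mat_carrier[of n a] k by simp
  also have "\<dots> = (a \<bullet> b) * c $ k - (a \<bullet> c) * b $ k"
    using assms k by (simp add: gcross_scalar_prod_gcross)
  finally show "(transpose_mat (gcross_mat n a) *\<^sub>v gcross n b c) $ k =
      ((a \<bullet> b) \<cdot>\<^sub>v c - (a \<bullet> c) \<cdot>\<^sub>v b) $ k"
    using assms k by simp
qed

lemma dyadic_carrier:
  assumes "u \<in> carrier_vec m" "v \<in> carrier_vec n"
  shows "dyadic u v \<in> carrier_mat m n"
  using assms by (intro carrier_matI) (simp_all add: dyadic_def)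

lemma dyadic_index:
  assumes "i < dim_vec u" "j < dim_vec v"
  shows "dyadic u v $$ (i, j) = u $ i * v $ j"
  using assms by (simp add: dyadic_def scalar_prod_def mat_of_row_def)

lemma dyadic_mult_vec:
  assumes "v \<in> carrier_vec n" "w \<in> carrier_vec n"
  shows "dyadic u v *\<^sub>v w = (v \<bullet> w) \<cdot>\<^sub>v u"
proof (rule eq_vecI)
  fix i assume "i < dim_vec ((v \<bullet> w) \<cdot>\<^sub>v u)"
  then have i: "i < dim_vec u" by simp
  have D: "dyadic u v \<in> carrier_mat (dim_vec u) n"
    using assms by (intro dyadic_carrier) auto
  then have "(dyadic u v *\<^sub>v w) $ i = (\<Sum>j = 0..<n. u $ i * v $ j * w $ j)"
    using i assms by (auto simp: scalar_prod_def dyadic_index)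
  then show "(dyadic u v *\<^sub>v w) $ i = ((v \<bullet> w) \<cdot>\<^sub>v u) $ i"
    using i assms by (simp add: scalar_prod_def sum_distrib_left sum_distrib_right mult_ac)
qed (simp add: dyadic_def)

lemma dyadic_diff_mult_vec:
  assumes "u \<in> carrier_vec n" "v \<in> carrier_vec n" "w \<in> carrier_vec n"
  shows "(dyadic u v - dyadic v u) *\<^sub>v w = (v \<bullet> w) \<cdot>\<^sub>v u - (u \<bullet> w) \<cdot>\<^sub>v v"
  unfolding minus_mult_distrib_mat_vec[OF dyadic_carrier[OF assms(1,2)]
      dyadic_carrier[OF assms(2,1)] assms(3)]
    dyadic_mult_vec[OF assms(1,3)] dyadic_mult_vec[OF assms(2,3)] by (rule refl)

lemma skew_of_vec_gcross:
  assumes "b \<in> carrier_vec n" "c \<in> carrier_vec n"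
  shows "skew_of_vec n (gcross n b c) = dyadic b c - dyadic c b"
proof -
  have D: "dyadic b c \<in> carrier_mat n n" "dyadic c b \<in> carrier_mat n n"
    using assms by (auto intro: dyadic_carrier)
  have "dyadic b c - dyadic c b \<in> skew_mats n"
    using D assms by (auto simp: skew_mats_def dyadic_index intro!: eq_matI)
  moreover have "upper_entries n (dyadic b c - dyadic c b) = gcross n b c"
    unfolding upper_entries_def gcross_entries using D assms
    by (intro arg_cong[where f = vec_of_list] map_cong)
      (auto simp: set_upper_pairs dyadic_index)
  ultimately show ?thesis
    using the_inv_into_f_f[OF bij_betw_imp_inj_on[OF upper_entries_bij_betw]]
    unfolding skew_of_vec_def by metis
qed

theorem mainTheorem1:
  fixes n :: nat and a b c :: "real vec"
  assumes "n \<ge> 2"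
    and "a \<in> carrier_vec n" and "b \<in> carrier_vec n" and "c \<in> carrier_vec n"
  shows "transpose_mat (gcross_mat n a) *\<^sub>v gcross n b c = (a \<bullet> b) \<cdot>\<^sub>v c - (a \<bullet> c) \<cdot>\<^sub>v b
    \<and> (a \<bullet> b) \<cdot>\<^sub>v c - (a \<bullet> c) \<cdot>\<^sub>v b = ((b \<bullet> a) \<cdot>\<^sub>m 1\<^sub>m n - dyadic b a) *\<^sub>v c
    \<and> ((b \<bullet> a) \<cdot>\<^sub>m 1\<^sub>m n - dyadic b a) *\<^sub>v c = (dyadic c b - dyadic b c) *\<^sub>v a
    \<and> (dyadic c b - dyadic b c) *\<^sub>v a = - (skew_of_vec n (gcross n b c) *\<^sub>v a)"
proof -
  note a = assms(2) and b = assms(3) and c = assms(4)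
  let ?g = "(a \<bullet> b) \<cdot>\<^sub>v c - (a \<bullet> c) \<cdot>\<^sub>v b"
  have ba: "b \<bullet> a = a \<bullet> b" and ca: "c \<bullet> a = a \<bullet> c"
    using comm_scalar_prod[OF b a] comm_scalar_prod[OF c a] by simp_all
  have I: "(a \<bullet> b) \<cdot>\<^sub>m 1\<^sub>m n \<in> carrier_mat n n"
    by simp
  have "((a \<bullet> b) \<cdot>\<^sub>m 1\<^sub>m n) *\<^sub>v c = (a \<bullet> b) \<cdot>\<^sub>v c"
    using c by (intro eq_vecI) simp_all
  then have scaled: "((b \<bullet> a) \<cdot>\<^sub>m 1\<^sub>m n - dyadic b a) *\<^sub>v c = ?g"
    by (simp only: ba minus_mult_distrib_mat_vec[OF I dyadic_carrier[OF b a] c]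
        dyadic_mult_vec[OF a c])
  have wedge: "(dyadic c b - dyadic b c) *\<^sub>v a = ?g"
    by (simp only: dyadic_diff_mult_vec[OF c b a] ba ca)
  have "- (skew_of_vec n (gcross n b c) *\<^sub>v a) = - ((a \<bullet> c) \<cdot>\<^sub>v b - (a \<bullet> b) \<cdot>\<^sub>v c)"
    by (simp only: skew_of_vec_gcross[OF b c] dyadic_diff_mult_vec[OF b c a] ba ca)
  also have "\<dots> = ?g"
    using b c by (intro eq_vecI) simp_all
  finally show ?thesis
    using transpose_gcross_mat_mult_gcross[OF a b c] scaled wedge by simp
qed

end
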